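(* Let $\{C_i\}_{i=1}^N$ be a sliding window of $N$ recent episodic costs. Let $\hat\beta_{\mathrm{CVaR}}=\mathrm{CVaR}_\epsilon(\{C_i\})$ and $\hat\beta_{\mathrm{EXP}}=\mathbb{E}[\{C_i\}]$ be the empirical estimates of CVaR and of expected cost, respectively. For any safety threshold $\beta>0$ and risk level $\epsilon\in(0,1)$, the constraint violation signals satisfy the following. Signal strength: the CVaR-based violation signal is always algebraically greater than or equal to the expected-cost signal, $$\hat\beta_{\mathrm{CVaR}}-\beta\ \ge\ \hat\beta_{\mathrm{EXP}}-\beta,$$ with strict inequality whenever the costs in the window are not all identical. Specifically, the relationship is given by the identity $$(\hat\beta_{\mathrm{CVaR}}-\beta)-(\hat\beta_{\mathrm{EXP}}-\beta)=\left(1-\frac kN\right)(\hat\beta_{\mathrm{CVaR}}-\hat\beta_{\mathrm{body}})\ge 0,$$ where $k=\lceil\epsilon N\rceil$ is the number of tail samples and $\hat\beta_{\mathrm{body}}$ is the mean of the lower $N-k$ ordered costs. Consequently, in the Lagrange multiplier update $\lambda_{t+1}=\max(0,\lambda_t+\eta(\hat\beta-\beta))$, the CVaR-based update (with $\hat\beta=\hat\beta_{\mathrm{CVaR}}$) always yields a larger positive adjustment (or a smaller negative decay) to $\lambda$ compared to the expected-cost update (with $\hat\beta=\hat\beta_{\mathrm{EXP}}$). When costs exceed the threshold ($\hat\beta>\beta$), CVaR provides a stronger penalty increase; when below threshold ($\hat\beta<\beta$), CVaR results in a slower safety relaxation.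
   Context: Write $C_{(1)}\le C_{(2)}\le\dots\le C_{(N)}$ for the order statistics of the costs, and $k=\lceil\epsilon N\rceil$. The empirical Conditional Value-at-Risk at level $\epsilon$ is the mean of the $k$ largest costs, $\hat\beta_{\mathrm{CVaR}}=\frac1k\sum_{i=N-k+1}^N C_{(i)}$; the empirical expected cost is the arithmetic mean $\hat\beta_{\mathrm{EXP}}=\frac1N\sum_{i=1}^N C_{(i)}$; and $\hat\beta_{\mathrm{body}}=\frac1{N-k}\sum_{i=1}^{N-k}C_{(i)}$. Here $\lambda_t\ge0$ is the Lagrange multiplier penalizing constraint violation and $\eta>0$ its learning rate.
   Formalization: Strict inequality is claimed only when the costs are not all identical and k < N (if k = N, CVaR equals the mean); the strictly slower decay of λ also needs the CVaR update not to be clipped to 0; otherwise the update comparisons are non-strict. *)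

theory Defs
  imports Complex_Main "HOL-Library.Multiset"
begin

definition tail_size :: "real \<Rightarrow> nat \<Rightarrow> nat" where
  "tail_size \<epsilon> N = nat \<lceil>\<epsilon> * real N\<rceil>"

text \<open>A window of \<open>N\<close> costs is the restriction of \<open>C\<close> to \<open>{1..N}\<close>; order statistics are
  indexed from 1, so that \<open>order_stat C N i\<close> is meaningful only for \<open>i \<in> {1..N}\<close>.\<close>

definition order_stat :: "(nat \<Rightarrow> real) \<Rightarrow> nat \<Rightarrow> nat \<Rightarrow> real" where
  "order_stat C N i = sort (map C [1..<Suc N]) ! (i - 1)"

definition emp_cvar :: "real \<Rightarrow> (nat \<Rightarrow> real) \<Rightarrow> nat \<Rightarrow> real" where
  "emp_cvar \<epsilon> C N =
     1 / real (tail_size \<epsilon> N) * (\<Sum>i = N - tail_size \<epsilon> N + 1..N. order_stat C N i)"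

definition emp_mean :: "(nat \<Rightarrow> real) \<Rightarrow> nat \<Rightarrow> real" where
  "emp_mean C N = 1 / real N * (\<Sum>i = 1..N. order_stat C N i)"

text \<open>If \<open>tail_size \<epsilon> N = N\<close>, there is no body and the value below is the conventional \<open>0\<close>.\<close>

definition emp_body :: "real \<Rightarrow> (nat \<Rightarrow> real) \<Rightarrow> nat \<Rightarrow> real" where
  "emp_body \<epsilon> C N =
     1 / real (N - tail_size \<epsilon> N) * (\<Sum>i = 1..N - tail_size \<epsilon> N. order_stat C N i)"

definition all_identical :: "(nat \<Rightarrow> real) \<Rightarrow> nat \<Rightarrow> bool" where
  "all_identical C N \<longleftrightarrow> (\<forall>i\<in>{1..N}. \<forall>j\<in>{1..N}. C i = C j)"

definition multiplier_update :: "real \<Rightarrow> real \<Rightarrow> real \<Rightarrow> real \<Rightarrow> real" where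
  "multiplier_update \<eta> \<beta> lam b = max 0 (lam + \<eta> * (b - \<beta>))"

lemma emp_mean_eq: "emp_mean C N = (\<Sum>i = 1..N. C i) / real N"
proof -
  let ?s = "sort (map C [1..<Suc N])"
  have "(\<Sum>i = 1..N. order_stat C N i) = (\<Sum>i = 0..<N. ?s ! i)"
    by (rule sum.reindex_bij_witness[of _ Suc "\<lambda>i. i - 1"]) (auto simp: order_stat_def)
  also have "\<dots> = sum_list ?s"
    by (simp add: sum_list_sum_nth del: upt_Suc)
  also have "\<dots> = sum_list (map C [1..<Suc N])"
    by (metis mset_sort sum_mset_sum_list)
  also have "\<dots> = (\<Sum>i = 1..N. C i)"
    by (simp add: interv_sum_list_conv_sum_set_nat atLeastLessThanSuc_atLeastAtMost del: upt_Suc)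
  finally show ?thesis
    by (simp add: emp_mean_def)
qed

end

theory Submission
  imports Defs
begin

text \<open>The smallest tail cost separates the tail from the body, so the tail mean is at least the body
  mean; if the costs are not all identical, the pivot differs from the smallest or the largest cost,
  which makes one of the two comparisons strict.  The overall mean is a convex combination of both
  means, and the multiplier update is monotone in the estimate.\<close>

text \<open>The upper bound is attained exactly when \<epsilon> > 1 - 1/N. The body is then empty, a
  case that later arguments treat apart.\<close>

lemma tail_size_bounds:
  assumes "N \<ge> 1" "0 < \<epsilon>" "\<epsilon> < 1"
  shows "1 \<le> tail_size \<epsilon> N" "tail_size \<epsilon> N \<le> N"
proof -
  have "0 < \<epsilon> * real N" "\<epsilon> * real N \<le> real N"
    using assms by (auto simp: mult_le_cancel_right1)
  then show "1 \<le> tail_size \<epsilon> N" "tail_size \<epsilon> N \<le> N"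
    unfolding tail_size_def by linarith+
qed

lemma order_stat_mono:
  assumes "1 \<le> i" "i \<le> j" "j \<le> N"
  shows "order_stat C N i \<le> order_stat C N j"
  unfolding order_stat_def using assms
  by (intro sorted_nth_mono) (auto simp del: upt_Suc)

text \<open>Every cost occurs in the sorted list and so lies between its two ends; if these
  coincided, all costs would be equal.\<close>

lemma order_stat_1_less_order_stat_N:
  assumes "\<not> all_identical C N"
  shows "order_stat C N 1 < order_stat C N N"
proof (rule ccontr)
  assume not_less: "\<not> ?thesis"
  have "C i = order_stat C N 1" if i: "i \<in> {1..N}" for i
  proof -
    have "C i \<in> set (sort (map C [1..<Suc N]))"
      using i by (auto simp del: upt_Suc)
    \<comment> \<open>List positions start at 0, so position \<open>m\<close> holds order statistic
      \<open>Suc m\<close>.\<close>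
    then obtain m where "m < N" "C i = order_stat C N (Suc m)"
      unfolding order_stat_def in_set_conv_nth by (auto simp del: upt_Suc)
    then show ?thesis
      using not_less order_stat_mono[of 1 "Suc m" N C] order_stat_mono[of "Suc m" N N C] by simp
  qed
  then show False
    using assms by (simp add: all_identical_def)
qed

text \<open>\<open>p\<close> is the smallest tail cost, hence a lower bound for each term of the
  tail average.\<close>

lemma emp_cvar_ge_pivot:
  fixes C :: "nat \<Rightarrow> real"
  assumes "1 \<le> tail_size \<epsilon> N" "tail_size \<epsilon> N \<le> N"
  defines "p \<equiv> order_stat C N (N - tail_size \<epsilon> N + 1)"
  shows "p \<le> emp_cvar \<epsilon> C N"
    and "p < order_stat C N N \<Longrightarrow> p < emp_cvar \<epsilon> C N"
proof -
  let ?k = "tail_size \<epsilon> N"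
  let ?A = "{N - ?k + 1..N}"
  have ge: "\<forall>i\<in>?A. p \<le> order_stat C N i"
    unfolding p_def by (auto intro: order_stat_mono)
  have const: "(\<Sum>i\<in>?A. p) = real ?k * p"
    using assms(2) by simp
  have "(\<Sum>i\<in>?A. p) \<le> (\<Sum>i\<in>?A. order_stat C N i)"
    using ge by (intro sum_mono) auto
  then show "p \<le> emp_cvar \<epsilon> C N"
    unfolding const emp_cvar_def using assms(1) by (simp add: field_simps)
  assume "p < order_stat C N N"
  \<comment> \<open>The strict term is the one at index \<open>N\<close>, which is in the tail
    because \<open>?k\<close> is at least 1.\<close>
  then have "(\<Sum>i\<in>?A. p) < (\<Sum>i\<in>?A. order_stat C N i)"
    using ge assms(1,2) by (intro sum_strict_mono_ex1) auto
  then show "p < emp_cvar \<epsilon> C N"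
    unfolding const emp_cvar_def using assms(1) by (simp add: field_simps)
qed

text \<open>Mirror image of the tail bound: sortedness puts every body cost below the first tail
  cost. Strictness comes from index 1, which is in the body because the tail is not the whole
  window.\<close>

lemma emp_body_le_pivot:
  fixes C :: "nat \<Rightarrow> real"
  assumes "1 \<le> tail_size \<epsilon> N" "tail_size \<epsilon> N < N"
  defines "p \<equiv> order_stat C N (N - tail_size \<epsilon> N + 1)"
  shows "emp_body \<epsilon> C N \<le> p"
    and "order_stat C N 1 < p \<Longrightarrow> emp_body \<epsilon> C N < p"
proof -
  let ?m = "N - tail_size \<epsilon> N"
  have le: "\<forall>i\<in>{1..?m}. order_stat C N i \<le> p"
    unfolding p_def using assms(1,2) by (auto intro!: order_stat_mono)
  have const: "(\<Sum>i = 1..?m. p) = real ?m * p"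
    by simp
  have pos: "0 < real ?m"
    using assms(2) by simp
  have "(\<Sum>i = 1..?m. order_stat C N i) \<le> (\<Sum>i = 1..?m. p)"
    using le by (intro sum_mono) auto
  then show "emp_body \<epsilon> C N \<le> p"
    unfolding const emp_body_def using pos by (simp add: pos_divide_le_eq mult.commute)
  assume "order_stat C N 1 < p"
  then have "(\<Sum>i = 1..?m. order_stat C N i) < (\<Sum>i = 1..?m. p)"
    using le assms(2) by (intro sum_strict_mono_ex1) auto
  then show "emp_body \<epsilon> C N < p"
    unfolding const emp_body_def using pos by (simp add: pos_divide_less_eq mult.commute)
qed

lemma emp_cvar_ge_emp_body:
  assumes "1 \<le> tail_size \<epsilon> N" "tail_size \<epsilon> N < N"
  shows "emp_body \<epsilon> C N \<le> emp_cvar \<epsilon> C N"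
    and "\<not> all_identical C N \<Longrightarrow> emp_body \<epsilon> C N < emp_cvar \<epsilon> C N"
  using emp_body_le_pivot[OF assms, of C] emp_cvar_ge_pivot[OF assms(1) less_imp_le[OF assms(2)], of C]
    order_stat_1_less_order_stat_N[of C N]
  by linarith+

text \<open>Splitting the full sum at the pivot gives N * mean = (N - k) * body + k * CVaR; dividing
  by N and rearranging yields the identity.\<close>

lemma emp_cvar_minus_emp_mean:
  assumes "1 \<le> tail_size \<epsilon> N" "tail_size \<epsilon> N \<le> N"
  shows "emp_cvar \<epsilon> C N - emp_mean C N
    = (1 - real (tail_size \<epsilon> N) / real N) * (emp_cvar \<epsilon> C N - emp_body \<epsilon> C N)"
proof -
  let ?k = "tail_size \<epsilon> N"
  let ?s = "order_stat C N"
  have N: "real N > 0"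
    using assms by simp
  have "{1..N} = {1..N - ?k} \<union> {N - ?k + 1..N}"
    using assms by auto
  then have "(\<Sum>i = 1..N. ?s i) = (\<Sum>i = 1..N - ?k. ?s i) + (\<Sum>i = N - ?k + 1..N. ?s i)"
    by (simp add: sum.union_disjoint)
  \<comment> \<open>For \<open>?k = N\<close> both sides are 0: the sum is empty and the factor in
    front of the body mean vanishes.\<close>
  moreover have "(\<Sum>i = 1..N - ?k. ?s i) = (real N - real ?k) * emp_body \<epsilon> C N"
    using assms by (cases "?k = N") (auto simp: emp_body_def of_nat_diff)
  moreover have "(\<Sum>i = N - ?k + 1..N. ?s i) = real ?k * emp_cvar \<epsilon> C N"
    using assms by (simp add: emp_cvar_def)
  moreover have "(\<Sum>i = 1..N. ?s i) = real N * emp_mean C N"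
    using N by (simp add: emp_mean_def)
  ultimately have "real N * emp_mean C N
      = (real N - real ?k) * emp_body \<epsilon> C N + real ?k * emp_cvar \<epsilon> C N"
    by simp
  with N show ?thesis
    by (simp add: field_simps)
qed

text \<open>The strict claims assume a nonempty body, since for k = N the CVaR equals the mean.
  Strictly slower relaxation also assumes a positive CVaR update, since otherwise both updates are
  clipped to 0.\<close>

theorem theoremB5:
  fixes C :: "nat \<Rightarrow> real" and N :: nat and \<epsilon> \<beta> \<eta> lam :: real
  assumes "N \<ge> 1" and "0 < \<epsilon>" and "\<epsilon> < 1" and "\<beta> > 0" and "\<eta> > 0" and "lam \<ge> 0"
  shows
    "emp_cvar \<epsilon> C N - \<beta> \<ge> emp_mean C N - \<beta>
   \<and> (tail_size \<epsilon> N < N \<and> \<not> all_identical C N \<longrightarrow>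
        emp_cvar \<epsilon> C N - \<beta> > emp_mean C N - \<beta>)
   \<and> (emp_cvar \<epsilon> C N - \<beta>) - (emp_mean C N - \<beta>)
        = (1 - real (tail_size \<epsilon> N) / real N) * (emp_cvar \<epsilon> C N - emp_body \<epsilon> C N)
   \<and> (1 - real (tail_size \<epsilon> N) / real N) * (emp_cvar \<epsilon> C N - emp_body \<epsilon> C N) \<ge> 0
   \<and> \<eta> * (emp_cvar \<epsilon> C N - \<beta>) \<ge> \<eta> * (emp_mean C N - \<beta>)
   \<and> (tail_size \<epsilon> N < N \<and> \<not> all_identical C N \<longrightarrow>
        \<eta> * (emp_cvar \<epsilon> C N - \<beta>) > \<eta> * (emp_mean C N - \<beta>))
   \<and> multiplier_update \<eta> \<beta> lam (emp_cvar \<epsilon> C N) - lam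
        \<ge> multiplier_update \<eta> \<beta> lam (emp_mean C N) - lam
   \<and> (emp_mean C N > \<beta> \<longrightarrow> multiplier_update \<eta> \<beta> lam (emp_mean C N) - lam > 0)
   \<and> (emp_cvar \<epsilon> C N > \<beta> \<longrightarrow>
        multiplier_update \<eta> \<beta> lam (emp_cvar \<epsilon> C N) - lam > 0
      \<and> multiplier_update \<eta> \<beta> lam (emp_cvar \<epsilon> C N) - lam
          \<ge> multiplier_update \<eta> \<beta> lam (emp_mean C N) - lam
      \<and> (tail_size \<epsilon> N < N \<and> \<not> all_identical C N \<longrightarrow>
           multiplier_update \<eta> \<beta> lam (emp_cvar \<epsilon> C N) - lam
             > multiplier_update \<eta> \<beta> lam (emp_mean C N) - lam))
   \<and> (emp_cvar \<epsilon> C N < \<beta> \<longrightarrow> lam - multiplier_update \<eta> \<beta> lam (emp_cvar \<epsilon> C N) \<ge> 0)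
   \<and> (emp_mean C N < \<beta> \<longrightarrow>
        lam - multiplier_update \<eta> \<beta> lam (emp_mean C N) \<ge> 0
      \<and> lam - multiplier_update \<eta> \<beta> lam (emp_cvar \<epsilon> C N)
          \<le> lam - multiplier_update \<eta> \<beta> lam (emp_mean C N)
      \<and> (tail_size \<epsilon> N < N \<and> \<not> all_identical C N
           \<and> multiplier_update \<eta> \<beta> lam (emp_cvar \<epsilon> C N) > 0 \<longrightarrow>
           lam - multiplier_update \<eta> \<beta> lam (emp_cvar \<epsilon> C N)
             < lam - multiplier_update \<eta> \<beta> lam (emp_mean C N)))"
proof -
  let ?k = "tail_size \<epsilon> N"
  let ?gap = "(1 - real ?k / real N) * (emp_cvar \<epsilon> C N - emp_body \<epsilon> C N)"
  note k = tail_size_bounds[OF assms(1-3)]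
  note gap_eq = emp_cvar_minus_emp_mean[OF k, of C]
  have gap_nonneg: "0 \<le> ?gap"
    using k emp_cvar_ge_emp_body(1)[of \<epsilon> N C] by (cases "?k = N") auto
  have gap_pos: "0 < ?gap" if "?k < N \<and> \<not> all_identical C N"
    using that k emp_cvar_ge_emp_body(2)[of \<epsilon> N C] by (intro mult_pos_pos) auto
  \<comment> \<open>The increments before clipping; their signs encode on which side of \<beta> each
    estimate lies, so what remains is a comparison of \<open>max 0 (lam + x)\<close> with
    \<open>max 0 (lam + y)\<close>.\<close>
  define x y where "x = \<eta> * (emp_cvar \<epsilon> C N - \<beta>)" and "y = \<eta> * (emp_mean C N - \<beta>)"
  have mono: "y \<le> x"
    using gap_eq gap_nonneg \<open>\<eta> > 0\<close> unfolding x_def y_def by simp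
  have strict: "y < x" if "?k < N \<and> \<not> all_identical C N"
    using gap_eq gap_pos[OF that] \<open>\<eta> > 0\<close> unfolding x_def y_def by simp
  have sgn: "0 < x \<longleftrightarrow> \<beta> < emp_cvar \<epsilon> C N" "x < 0 \<longleftrightarrow> emp_cvar \<epsilon> C N < \<beta>"
    "0 < y \<longleftrightarrow> \<beta> < emp_mean C N" "y < 0 \<longleftrightarrow> emp_mean C N < \<beta>"
    using \<open>\<eta> > 0\<close> by (auto simp: x_def y_def zero_less_mult_iff mult_less_0_iff)
  show ?thesis
    \<comment> \<open>If \<open>0 < x\<close>, then \<open>lam \<ge> 0\<close> makes
      \<open>lam + x\<close> positive, so clipping preserves a strict inequality
      \<open>y < x\<close>.\<close>
    unfolding multiplier_update_def x_def[symmetric] y_def[symmetric] sgn[symmetric]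
    using gap_eq gap_nonneg gap_pos mono strict \<open>lam \<ge> 0\<close>
    by (intro conjI impI) (auto simp: max_def split: if_splits)
qed

end
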